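(* Let $S$ be a finite or countable set, let $\pi : S \to (0,\infty)$ satisfy $\sum_{x\in S}\pi(x) < \infty$ (not necessarily normalized), let $Q = (Q(x,y))_{x,y\in S}$ be a matrix of transition probabilities on $S$, and let $\Gamma = (\Gamma(x,y))_{x,y \in S}$ be a vorticity matrix. Suppose that (a) for all $x,y\in S$, $Q(x,y) = 0$ implies $Q(y,x)=0$; (b) $\Gamma(x,y) \ge -\pi(y) Q(y,x)$ for all $x,y\in S$. Let $P_\Gamma$ be the non-reversible Metropolis-Hastings transition matrix built from $(Q,\Gamma,\pi)$. Then $P_\Gamma$ has $\pi$ as invariant distribution, i.e. $\sum_{x\in S}\pi(x)P_\Gamma(x,y)=\pi(y)$ for all $y\in S$, and $\Gamma$ is the vorticity matrix of $(P_\Gamma,\pi)$, i.e. $\Gamma(x,y) = \pi(x)P_\Gamma(x,y)-\pi(y)P_\Gamma(y,x)$ for all $x,y\in S$.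
   Context: A vorticity matrix on $S$ is a real matrix $\Gamma=(\Gamma(x,y))_{x,y\in S}$ that is skew-symmetric, $\Gamma(x,y)=-\Gamma(y,x)$ for all $x,y$, and satisfies $\Gamma \mathbf{1}=0$, i.e. $\sum_{y\in S}\Gamma(x,y)=0$ for all $x\in S$. Non-reversible Metropolis-Hastings (NRMH): given $(Q,\Gamma,\pi)$, define for $x,y\in S$ the non-reversible Hastings ratio $$R_\Gamma(x,y) = \frac{\Gamma(x,y)+\pi(y)Q(y,x)}{\pi(x)Q(x,y)} \ \text{ if } \pi(x)Q(x,y)\neq 0, \qquad R_\Gamma(x,y)=1 \ \text{ otherwise},$$ the acceptance probabilities $A_\Gamma(x,y)=\min(1,R_\Gamma(x,y))$, and the transition matrix $$P_\Gamma(x,y)=Q(x,y)A_\Gamma(x,y)\ \ (x\ne y),\qquad P_\Gamma(x,x)=Q(x,x)+\sum_{z\neq x}Q(x,z)(1-A_\Gamma(x,z)).$$ *)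

theory Defs
  imports "HOL-Analysis.Infinite_Sum" "HOL-Library.Countable_Set"
begin

text \<open>
  Matrices indexed by a set \<open>S\<close> are functions \<open>'a \<Rightarrow> 'a \<Rightarrow> real\<close>; their values outside
  \<open>S\<close> play no role. Sums over \<open>S\<close> are unconditional sums, \<open>has_sum\<close> including the claim
  that the sum converges.
\<close>

definition transition_matrix :: "'a set \<Rightarrow> ('a \<Rightarrow> 'a \<Rightarrow> real) \<Rightarrow> bool" where
  "transition_matrix S Q \<longleftrightarrow>
     (\<forall>x\<in>S. (\<forall>y\<in>S. Q x y \<ge> 0) \<and> ((\<lambda>y. Q x y) has_sum 1) S)"

definition vorticity_matrix :: "'a set \<Rightarrow> ('a \<Rightarrow> 'a \<Rightarrow> real) \<Rightarrow> bool" where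
  "vorticity_matrix S \<Gamma> \<longleftrightarrow>
     (\<forall>x\<in>S. \<forall>y\<in>S. \<Gamma> x y = - \<Gamma> y x) \<and> (\<forall>x\<in>S. ((\<lambda>y. \<Gamma> x y) has_sum 0) S)"

definition hastings_ratio ::
  "('a \<Rightarrow> 'a \<Rightarrow> real) \<Rightarrow> ('a \<Rightarrow> 'a \<Rightarrow> real) \<Rightarrow> ('a \<Rightarrow> real) \<Rightarrow> 'a \<Rightarrow> 'a \<Rightarrow> real" where
  "hastings_ratio Q \<Gamma> \<pi> x y =
     (if \<pi> x * Q x y \<noteq> 0 then (\<Gamma> x y + \<pi> y * Q y x) / (\<pi> x * Q x y) else 1)"

definition acceptance ::
  "('a \<Rightarrow> 'a \<Rightarrow> real) \<Rightarrow> ('a \<Rightarrow> 'a \<Rightarrow> real) \<Rightarrow> ('a \<Rightarrow> real) \<Rightarrow> 'a \<Rightarrow> 'a \<Rightarrow> real" where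
  "acceptance Q \<Gamma> \<pi> x y = min 1 (hastings_ratio Q \<Gamma> \<pi> x y)"

text \<open>
  The sum on the diagonal converges if \<open>Q\<close> is a transition matrix, \<open>\<pi>\<close> is positive and
  \<open>\<Gamma> x y \<ge> - \<pi> y * Q y x\<close> on \<open>S\<close>: then acceptance probabilities lie between 0 and 1, so
  the terms lie between 0 and \<open>Q x z\<close>.
\<close>

definition nrmh ::
  "'a set \<Rightarrow> ('a \<Rightarrow> 'a \<Rightarrow> real) \<Rightarrow> ('a \<Rightarrow> 'a \<Rightarrow> real) \<Rightarrow> ('a \<Rightarrow> real) \<Rightarrow> 'a \<Rightarrow> 'a \<Rightarrow> real" where
  "nrmh S Q \<Gamma> \<pi> x y =
     (if x \<noteq> y then Q x y * acceptance Q \<Gamma> \<pi> x y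
      else Q x x + (\<Sum>\<^sub>\<infinity>z\<in>S - {x}. Q x z * (1 - acceptance Q \<Gamma> \<pi> x z)))"

definition invariant_distribution ::
  "'a set \<Rightarrow> ('a \<Rightarrow> 'a \<Rightarrow> real) \<Rightarrow> ('a \<Rightarrow> real) \<Rightarrow> bool" where
  "invariant_distribution S P \<pi> \<longleftrightarrow> (\<forall>y\<in>S. ((\<lambda>x. \<pi> x * P x y) has_sum \<pi> y) S)"

definition is_vorticity_of ::
  "'a set \<Rightarrow> ('a \<Rightarrow> 'a \<Rightarrow> real) \<Rightarrow> ('a \<Rightarrow> 'a \<Rightarrow> real) \<Rightarrow> ('a \<Rightarrow> real) \<Rightarrow> bool" where
  "is_vorticity_of S \<Gamma> P \<pi> \<longleftrightarrow>
     (\<forall>x\<in>S. \<forall>y\<in>S. \<Gamma> x y = \<pi> x * P x y - \<pi> y * P y x)"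

end

theory Submission
  imports Defs
begin

text \<open>
  For \<open>x \<noteq> y\<close> the stationary flow of the Metropolis-Hastings chain is
  \<open>\<pi> x * P x y = min (\<pi> x * Q x y) (\<Gamma> x y + \<pi> y * Q y x)\<close> (lemma \<open>nrmh_flow\<close>). Exchanging
  \<open>x\<close> and \<open>y\<close> and using \<open>\<Gamma> y x = - \<Gamma> x y\<close>, the reverse flow is the minimum of the same two
  numbers, each lowered by \<open>\<Gamma> x y\<close>. The two flows therefore differ by exactly \<open>\<Gamma> x y\<close>, which is
  the vorticity claim (lemma \<open>nrmh_vorticity\<close>).

  Invariance follows by summing this relation: \<open>\<pi> y * P y x = \<pi> x * P x y - \<Gamma> x y\<close>, and over
  \<open>y\<close> the right-hand side sums to \<open>\<pi> x * 1 - 0\<close>, because the rows of \<open>P\<close> sum to \<open>1\<close> (lemma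
  \<open>nrmh_row_sum\<close>) and the rows of \<open>\<Gamma>\<close> to \<open>0\<close>.
\<close>

lemma has_sum_diff:
  fixes f g :: "'a \<Rightarrow> real"
  assumes "(f has_sum a) A" and "(g has_sum b) A"
  shows "((\<lambda>x. f x - g x) has_sum (a - b)) A"
  using has_sum_add[OF assms(1) has_sum_uminusI[OF assms(2)]] by simp

text \<open>
  The lower bound on \<open>\<Gamma>\<close> says precisely that the numerator of the Hastings ratio is nonnegative.
\<close>

lemma acceptance_bounds:
  assumes "\<pi> x * Q x y \<ge> 0" and "\<Gamma> x y \<ge> - \<pi> y * Q y x"
  shows "0 \<le> acceptance Q \<Gamma> \<pi> x y" and "acceptance Q \<Gamma> \<pi> x y \<le> 1"
  using assms by (auto simp: acceptance_def hastings_ratio_def)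

text \<open>
  Multiplying the acceptance probability by \<open>\<pi> x * Q x y\<close> clears the denominator. The last
  hypothesis covers the default value of the ratio: there the flow is \<open>0\<close>, so the formula needs
  both arguments of the minimum to vanish.
\<close>

lemma nrmh_flow:
  assumes "x \<noteq> y" and "\<pi> x * Q x y \<ge> 0"
    and "\<pi> x * Q x y = 0 \<Longrightarrow> \<Gamma> x y + \<pi> y * Q y x = 0"
  shows "\<pi> x * nrmh S Q \<Gamma> \<pi> x y = min (\<pi> x * Q x y) (\<Gamma> x y + \<pi> y * Q y x)"
proof -
  have flow: "\<pi> x * nrmh S Q \<Gamma> \<pi> x y = (\<pi> x * Q x y) * acceptance Q \<Gamma> \<pi> x y"
    using \<open>x \<noteq> y\<close> by (simp add: nrmh_def)
  show ?thesis
  proof (cases "\<pi> x * Q x y = 0")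
    case True
    then show ?thesis using flow assms(3) by (metis min.idem mult_zero_left)
  next
    case False
    have "(\<pi> x * Q x y) * min 1 ((\<Gamma> x y + \<pi> y * Q y x) / (\<pi> x * Q x y))
        = min (\<pi> x * Q x y) (\<Gamma> x y + \<pi> y * Q y x)"
      using False assms(2) by (simp add: min_mult_distrib_left)
    then show ?thesis using flow False by (simp add: acceptance_def hastings_ratio_def)
  qed
qed

lemma nrmh_vorticity:
  assumes "x \<in> S" and "y \<in> S"
    and pos: "\<And>x. x \<in> S \<Longrightarrow> \<pi> x > 0"
    and nonneg: "\<And>x y. x \<in> S \<Longrightarrow> y \<in> S \<Longrightarrow> Q x y \<ge> 0"
    and skew: "\<And>x y. x \<in> S \<Longrightarrow> y \<in> S \<Longrightarrow> \<Gamma> x y = - \<Gamma> y x"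
    and symm: "\<And>x y. x \<in> S \<Longrightarrow> y \<in> S \<Longrightarrow> Q x y = 0 \<Longrightarrow> Q y x = 0"
    and bound: "\<And>x y. x \<in> S \<Longrightarrow> y \<in> S \<Longrightarrow> \<Gamma> x y \<ge> - \<pi> y * Q y x"
  shows "\<Gamma> x y = \<pi> x * nrmh S Q \<Gamma> \<pi> x y - \<pi> y * nrmh S Q \<Gamma> \<pi> y x"
proof (cases "x = y")
  case True
  then show ?thesis using skew[of x x] \<open>x \<in> S\<close> by simp
next
  case False
  have flow: "\<pi> a * nrmh S Q \<Gamma> \<pi> a b = min (\<pi> a * Q a b) (\<Gamma> a b + \<pi> b * Q b a)"
    if "a \<in> S" "b \<in> S" "a \<noteq> b" for a b
  proof (rule nrmh_flow[OF \<open>a \<noteq> b\<close>])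
    show "\<pi> a * Q a b \<ge> 0" using pos nonneg that by (simp add: less_imp_le)
    assume "\<pi> a * Q a b = 0"
    with pos[of a] that have "Q a b = 0" by simp
    with symm that have "Q b a = 0" by blast
    \<comment> \<open>No proposals in either direction: the lower bounds on \<open>\<Gamma> a b\<close> and on
      \<open>\<Gamma> b a = - \<Gamma> a b\<close> are both \<open>0\<close>, so \<open>\<Gamma> a b\<close> vanishes.\<close>
    with \<open>Q a b = 0\<close> show "\<Gamma> a b + \<pi> b * Q b a = 0"
      using bound[of a b] bound[of b a] skew[of a b] that by simp
  qed
  have "\<pi> y * nrmh S Q \<Gamma> \<pi> y x = min (\<pi> y * Q y x) (- \<Gamma> x y + \<pi> x * Q x y)"
    using flow[of y x] skew[of y x] False assms(1,2) by simp
  then show ?thesis using flow[of x y] False assms(1,2) by (simp add: min_def)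
qed

text \<open>
  The diagonal entry puts the rejected mass back on \<open>x\<close>. As acceptance probabilities lie in
  \<open>[0, 1]\<close>, the rejected mass is dominated by the row of \<open>Q\<close>; the infinite sum defining it
  therefore converges and accepted and rejected mass can be added termwise.
\<close>

lemma nrmh_row_sum:
  assumes "x \<in> S"
    and nonneg: "\<And>y. y \<in> S \<Longrightarrow> Q x y \<ge> 0"
    and row: "((\<lambda>y. Q x y) has_sum 1) S"
    and acc: "\<And>y. y \<in> S \<Longrightarrow> 0 \<le> acceptance Q \<Gamma> \<pi> x y \<and> acceptance Q \<Gamma> \<pi> x y \<le> 1"
  shows "((\<lambda>y. nrmh S Q \<Gamma> \<pi> x y) has_sum 1) S"
proof -
  let ?A = "acceptance Q \<Gamma> \<pi> x"
  let ?T = "S - {x}"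
  define r where "r = (\<Sum>\<^sub>\<infinity>z\<in>?T. Q x z * (1 - ?A z))"
  have Q: "((\<lambda>y. Q x y) has_sum (1 - Q x x)) ?T"
    using has_sum_Diff[OF row has_sum_finite[of "{x}" "Q x"]] \<open>x \<in> S\<close> by simp
  have "(\<lambda>z. Q x z * (1 - ?A z)) summable_on ?T"
  proof (rule summable_on_comparison_test)
    show "(\<lambda>y. Q x y) summable_on ?T" using Q has_sum_imp_summable by blast
    fix z assume "z \<in> ?T"
    then show "Q x z * (1 - ?A z) \<le> Q x z" and "0 \<le> Q x z * (1 - ?A z)"
      using nonneg[of z] acc[of z] by (auto intro: mult_left_le)
  qed
  then have R: "((\<lambda>z. Q x z * (1 - ?A z)) has_sum r) ?T"
    unfolding r_def by simp
  have "((\<lambda>z. nrmh S Q \<Gamma> \<pi> x z) has_sum (1 - Q x x - r)) ?T"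
  proof (rule has_sum_cong[THEN iffD1, OF _ has_sum_diff[OF Q R]])
    fix z assume "z \<in> ?T"
    then show "Q x z - Q x z * (1 - ?A z) = nrmh S Q \<Gamma> \<pi> x z"
      by (auto simp: nrmh_def algebra_simps)
  qed
  then have "((\<lambda>z. nrmh S Q \<Gamma> \<pi> x z) has_sum
      (nrmh S Q \<Gamma> \<pi> x x + (1 - Q x x - r))) (insert x ?T)"
    by (intro has_sum_insert) auto
  moreover have "nrmh S Q \<Gamma> \<pi> x x = Q x x + r" by (simp add: nrmh_def r_def)
  ultimately show ?thesis using \<open>x \<in> S\<close> by (simp add: insert_absorb)
qed

text \<open>
  Summing the vorticity relation over the second index turns the row sums of \<open>P\<close> and \<open>\<Gamma>\<close> into
  the balance equation at the first one.
\<close>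

lemma invariant_distribution_if_vorticity:
  assumes rowP: "\<And>x. x \<in> S \<Longrightarrow> ((\<lambda>y. P x y) has_sum 1) S"
    and row\<Gamma>: "\<And>x. x \<in> S \<Longrightarrow> ((\<lambda>y. \<Gamma> x y) has_sum 0) S"
    and vort: "is_vorticity_of S \<Gamma> P \<pi>"
  shows "invariant_distribution S P \<pi>"
  unfolding invariant_distribution_def
proof
  fix x assume x: "x \<in> S"
  have "((\<lambda>y. \<pi> x * P x y - \<Gamma> x y) has_sum \<pi> x) S"
    using has_sum_diff[OF has_sum_cmult_right[OF rowP[OF x], of "\<pi> x"] row\<Gamma>[OF x]] by simp
  moreover have "\<pi> x * P x y - \<Gamma> x y = \<pi> y * P y x" if "y \<in> S" for y
    using vort x that by (simp add: is_vorticity_of_def)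
  ultimately show "((\<lambda>y. \<pi> y * P y x) has_sum \<pi> x) S"
    by (simp cong: has_sum_cong)
qed

theorem theorem2p5:
  fixes S :: "'a set"
    and \<pi> :: "'a \<Rightarrow> real"
    and Q \<Gamma> :: "'a \<Rightarrow> 'a \<Rightarrow> real"
  assumes "countable S"
    and "\<And>x. x \<in> S \<Longrightarrow> \<pi> x > 0"
    and "\<pi> summable_on S"
    and "transition_matrix S Q"
    and "vorticity_matrix S \<Gamma>"
    and "\<And>x y. x \<in> S \<Longrightarrow> y \<in> S \<Longrightarrow> Q x y = 0 \<Longrightarrow> Q y x = 0"
    and "\<And>x y. x \<in> S \<Longrightarrow> y \<in> S \<Longrightarrow> \<Gamma> x y \<ge> - \<pi> y * Q y x"
  shows "invariant_distribution S (nrmh S Q \<Gamma> \<pi>) \<pi> \<and>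
         is_vorticity_of S \<Gamma> (nrmh S Q \<Gamma> \<pi>) \<pi>"
proof -
  have nonneg: "Q x y \<ge> 0" if "x \<in> S" "y \<in> S" for x y
    using assms(4) that by (simp add: transition_matrix_def)
  have rowQ: "((\<lambda>y. Q x y) has_sum 1) S" if "x \<in> S" for x
    using assms(4) that by (simp add: transition_matrix_def)
  have skew: "\<Gamma> x y = - \<Gamma> y x" if "x \<in> S" "y \<in> S" for x y
    using assms(5) that unfolding vorticity_matrix_def by blast
  have row\<Gamma>: "((\<lambda>y. \<Gamma> x y) has_sum 0) S" if "x \<in> S" for x
    using assms(5) that by (simp add: vorticity_matrix_def)
  have acc: "0 \<le> acceptance Q \<Gamma> \<pi> x y \<and> acceptance Q \<Gamma> \<pi> x y \<le> 1"
    if "x \<in> S" "y \<in> S" for x y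
    using acceptance_bounds[of \<pi> x Q y \<Gamma>] assms(2)[of x] nonneg[of x y] assms(7)[of x y] that
    by simp
  have vort: "is_vorticity_of S \<Gamma> (nrmh S Q \<Gamma> \<pi>) \<pi>"
    unfolding is_vorticity_of_def
    using nrmh_vorticity[of _ S _ \<pi> Q \<Gamma>, OF _ _ assms(2) nonneg skew assms(6,7)] by blast
  have rowP: "((\<lambda>y. nrmh S Q \<Gamma> \<pi> x y) has_sum 1) S" if "x \<in> S" for x
    using nrmh_row_sum[OF that nonneg[OF that] rowQ[OF that] acc[OF that]] by blast
  show ?thesis
    using invariant_distribution_if_vorticity[OF rowP row\<Gamma> vort] vort by blast
qed

end
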